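(* Let $x^+\in G(x,v)$ be a stochastic difference inclusion on $\mathcal X\subseteq\mathbb R^n$ with random inputs in $\mathcal V\subseteq\mathbb R^m$, satisfying the standing assumptions (A1)–(A4) and the i.i.d. assumption listed in the context, and suppose that $G$ is a convex set-valued map, i.e. its graph $\{(x,v,y): (x,v)\in\mathcal X\times\mathcal V,\ y\in G(x,v)\}$ is convex. Let $B:\mathcal X\to\mathbb R_{\ge0}$ be a concave upper semicontinuous function, $\Delta>0$, $K_\Delta=\{x\in\mathcal X: B(x)\le\Delta\}$, $K_\Delta^C=\mathcal X\setminus K_\Delta$, $N\in\mathbb N$, $\rho\in[0,1)$ and $x\in K_\Delta$. If $$\mathbb E\Big[\sup_{k\in\{1,\dots,N\}}\lambda_k^B(x,v_0,\dots,v_{k-1})\Big]\le\rho\Delta,$$ then the set $K_\Delta^C$ is reachable from $x$ within $N$ steps with probability less than $\rho$, i.e. $$\mathbb P\big(\exists k\in\{1,\dots,N\}:\ \lambda_k^B(x,v_0,\dots,v_{k-1})>\Delta\big)<\rho.$$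
   Context: Setting. $G:\mathcal X\times\mathcal V\rightrightarrows\mathbb R^n$ is a set-valued map with $G(x,v)\subseteq\mathcal X$. Assumptions on $G$: (A1) for each $v\in\mathcal V$, $x\mapsto G(x,v)$ is upper semicontinuous, meaning that for every $x$ and $\epsilon>0$ there is a neighborhood $U(x)$ with $G(y,v)\subseteq G(x,v)+\epsilon\mathbb B$ for all $y\in U(x)\cap\mathcal X$ ($\mathbb B$ the open unit ball); (A2) $G$ is locally bounded: each point of $\mathcal X\times\mathcal V$ has a neighborhood on which all elements of the values of $G$ are bounded in norm by a common constant; (A3) each $G(x,v)$ is nonempty, closed and convex; (A4) $v\mapsto\operatorname{graph}(G(\cdot,v))=\{(x,y)\in\mathcal X\times\mathcal X: y\in G(x,v)\}$ is a measurable set-valued map (preimages $\{v:\operatorname{graph}(G(\cdot,v))\cap O\ne\emptyset\}$ of open sets $O$ are measurable). I.i.d. assumption: $(v_i)_{i\ge0}$ are i.i.d. random vectors on a probability space $(\Omega,\mathcal F,\mathbb P)$ with values in $\mathcal V$ and common distribution $\mu$ on the Borel sets of $\mathcal V$. Functions $\lambda_k^B:\mathcal X\times\mathcal V^k\to\mathbb R_{\ge0}$: $\lambda_0^B(x)=B(x)$ and $\lambda_{k+1}^B(x,v_0,\dots,v_k)=\sup_{x_1\in G(x,v_0)}\lambda_k^B(x_1,v_1,\dots,v_k)$. The set $K_\Delta^C$ can be reached at step $k$ from $x$ for inputs $v_0,\dots,v_{k-1}$ (some trajectory $x_0=x$, $x_{i+1}\in G(x_i,v_i)$ has $x_k\in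 K_\Delta^C$) iff $\lambda_k^B(x,v_0,\dots,v_{k-1})>\Delta$.
   Formalization: For ρ = 0 the strict bound "probability less than ρ" is impossible (B = 0 satisfies all hypotheses), so the formal theorem proves the strict bound for every ρ in (0,1) and that the probability equals 0 when ρ = 0. *)

theory Defs
  imports "HOL-Probability.Probability"
begin

text \<open>
  Throughout, a set-valued map on \<open>X \<times> V\<close> is a function \<open>G :: 'a \<Rightarrow> 'b \<Rightarrow> 'a set\<close>, of which only
  the values at \<open>x \<in> X\<close>, \<open>v \<in> V\<close> matter. Openness of neighbourhoods is in the ambient space,
  and the conditions are then imposed on the points lying in \<open>X\<close> (resp. \<open>X \<times> V\<close>).
\<close>

definition usc_set_map_on :: "'a::real_normed_vector set \<Rightarrow> ('a \<Rightarrow> 'a set) \<Rightarrow> bool" where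
  "usc_set_map_on X F \<longleftrightarrow>
    (\<forall>x\<in>X. \<forall>\<epsilon>>0. \<exists>U. open U \<and> x \<in> U \<and>
      (\<forall>y\<in>U \<inter> X. F y \<subseteq> {a + \<epsilon> *\<^sub>R b | a b. a \<in> F x \<and> b \<in> ball 0 1}))"

definition locally_bounded_set_map_on ::
  "'a::real_normed_vector set \<Rightarrow> 'b::topological_space set \<Rightarrow> ('a \<Rightarrow> 'b \<Rightarrow> 'a set) \<Rightarrow> bool" where
  "locally_bounded_set_map_on X V G \<longleftrightarrow>
    (\<forall>p\<in>X \<times> V. \<exists>U c. open U \<and> p \<in> U \<and>
      (\<forall>(x, v)\<in>U \<inter> (X \<times> V). \<forall>y\<in>G x v. norm y \<le> c))"

definition graph_at :: "'a set \<Rightarrow> ('a \<Rightarrow> 'b \<Rightarrow> 'a set) \<Rightarrow> 'b \<Rightarrow> ('a \<times> 'a) set" where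
  "graph_at X G v = {(x, y). x \<in> X \<and> y \<in> X \<and> y \<in> G x v}"

text \<open>Measurability refers to the Borel sets of the subspace \<open>V\<close>, which need not itself be Borel.\<close>

definition measurable_graph_map_on ::
  "'a::topological_space set \<Rightarrow> 'b::topological_space set \<Rightarrow> ('a \<Rightarrow> 'b \<Rightarrow> 'a set) \<Rightarrow> bool" where
  "measurable_graph_map_on X V G \<longleftrightarrow>
    (\<forall>W. open W \<longrightarrow>
      {v \<in> V. graph_at X G v \<inter> W \<noteq> {}} \<in> sets (restrict_space borel V))"

definition convex_set_map_on ::
  "'a::real_vector set \<Rightarrow> 'b::real_vector set \<Rightarrow> ('a \<Rightarrow> 'b \<Rightarrow> 'a set) \<Rightarrow> bool" where
  "convex_set_map_on X V G \<longleftrightarrow> convex {(x, v, y). x \<in> X \<and> v \<in> V \<and> y \<in> G x v}"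

definition usc_on :: "'a::topological_space set \<Rightarrow> ('a \<Rightarrow> real) \<Rightarrow> bool" where
  "usc_on X f \<longleftrightarrow> (\<forall>x\<in>X. \<forall>\<epsilon>>0. \<forall>\<^sub>F y in at x within X. f y < f x + \<epsilon>)"

text \<open>
  The function \<open>\<lambda>\<^sub>k\<^sup>B(x, v\<^sub>0, \<dots>, v\<^bsub>k-1\<^esub>)\<close>, with the tuple of inputs given as a list whose
  length is \<open>k\<close>. The supremum is the one of the reals; when \<open>B\<close> is upper semicontinuous and
  \<open>G\<close> is upper semicontinuous in \<open>x\<close> and locally bounded with nonempty closed values in \<open>X\<close>,
  it is taken over a nonempty set that is bounded above.
\<close>

primrec lambdaB :: "('a \<Rightarrow> 'b \<Rightarrow> 'a set) \<Rightarrow> ('a \<Rightarrow> real) \<Rightarrow> 'a \<Rightarrow> 'b list \<Rightarrow> real" where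
  "lambdaB G B x [] = B x"
| "lambdaB G B x (v # vs) = (SUP x1\<in>G x v. lambdaB G B x1 vs)"

definition reaches_at ::
  "('a \<Rightarrow> 'b \<Rightarrow> 'a set) \<Rightarrow> 'a set \<Rightarrow> nat \<Rightarrow> 'a \<Rightarrow> (nat \<Rightarrow> 'b) \<Rightarrow> bool" where
  "reaches_at G S k x v \<longleftrightarrow>
    (\<exists>\<xi>. \<xi> 0 = x \<and> (\<forall>i<k. \<xi> (Suc i) \<in> G (\<xi> i) (v i)) \<and> \<xi> k \<in> S)"

definition sublevel :: "'a set \<Rightarrow> ('a \<Rightarrow> real) \<Rightarrow> real \<Rightarrow> 'a set" where
  "sublevel X B \<Delta> = {x \<in> X. B x \<le> \<Delta>}"

end

theory Submission
  imports Defs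
begin

text \<open>
  The event in question is \<open>\<Lambda> > \<Delta>\<close> for \<open>\<Lambda> = sup\<^sub>k \<lambda>\<^sub>k\<close>, and the strict form of Markov's inequality
  bounds its probability once \<open>\<Lambda>\<close> is known to be measurable. For measurability, call a chain of
  points an \<open>e\<close>-pseudo-trajectory if it follows \<open>G\<close> up to jumps of size \<open>e\<close> through balls centred
  in a countable dense set. Existence of such a chain ending \<open>e\<close>-close to \<open>{c \<le> B}\<close> is, by (A4), a
  countable combination of measurable conditions on the inputs. By upper semicontinuity of \<open>G\<close> and \<open>B\<close>
  and compactness of the values of \<open>G\<close>, the chains exist for all \<open>e > 0\<close> when \<open>\<lambda>\<^sub>k > c\<close>, and only when
  \<open>\<lambda>\<^sub>k \<ge> c\<close>. The same estimate shows that \<open>\<lambda>\<^sub>k\<close> is upper semicontinuous in the state, so that the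
  suprema defining it are finite.
\<close>

section \<open>Uniform radii on compact sets and a strict Markov inequality\<close>

text \<open>A Lebesgue number argument: balls of half the local radius cover \<open>K\<close>, and a
  point closer to \<open>K\<close> than every half radius of a finite subcover stays in some full
  ball. \<open>P\<close> depends on the radius as well, so that the tolerance of a chain can shrink
  along with the ball.\<close>

lemma compact_uniform_radius:
  fixes K :: "'a::metric_space set"
  assumes "compact K"
    and local: "\<And>y. y \<in> K \<Longrightarrow> \<exists>\<delta>>0. \<forall>q\<in>ball y \<delta>. P \<delta> q"
    and mono: "\<And>\<delta> \<delta>' q. 0 < \<delta>' \<Longrightarrow> \<delta>' \<le> \<delta> \<Longrightarrow> P \<delta> q \<Longrightarrow> P \<delta>' q"
  shows "\<exists>\<delta>>0. \<forall>y\<in>K. \<forall>q\<in>ball y \<delta>. P \<delta> q"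
proof -
  obtain r where r: "r y > 0" "\<forall>q\<in>ball y (r y). P (r y) q" if "y \<in> K" for y
    using local by metis
  have "K \<subseteq> (\<Union>y\<in>K. ball y (r y / 2))"
    using r(1) by force
  then obtain T where T: "T \<subseteq> K" "finite T" "K \<subseteq> (\<Union>y\<in>T. ball y (r y / 2))"
    using compactE_image[OF \<open>compact K\<close>, of K "\<lambda>y. ball y (r y / 2)"] by blast
  \<comment> \<open>The extra 1 keeps \<open>Min\<close> meaningful when \<open>K\<close>, and hence
    \<open>T\<close>, is empty.\<close>
  define \<delta> where "\<delta> = Min (insert 1 ((\<lambda>y. r y / 2) ` T))"
  have "\<delta> > 0"
    using T r(1) by (auto simp: \<delta>_def)
  moreover have "P \<delta> q" if "y \<in> K" "dist y q < \<delta>" for y q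
  proof -
    obtain t where t: "t \<in> T" "dist t y < r t / 2"
      using T(3) \<open>y \<in> K\<close> by auto
    have "\<delta> \<le> r t / 2"
      unfolding \<delta>_def using t T(2) by (intro Min_le) auto
    moreover have "dist t q < r t"
      using dist_triangle[of t q y] t(2) that(2) \<open>\<delta> \<le> r t / 2\<close> by linarith
    moreover have "t \<in> K" "r t > 0"
      using t T(1) r(1) by auto
    ultimately show ?thesis
      using mono[OF \<open>\<delta> > 0\<close>, of "r t" q] r(2)[of t] by auto
  qed
  ultimately show ?thesis
    by (metis mem_ball)
qed

text \<open>On the event, \<open>f\<close> exceeds \<open>a\<close> strictly, so the usual
  comparison of integrals is strict unless the event is null. The second alternative covers
  \<open>\<rho> = 0\<close>.\<close>

lemma (in finite_measure) markov_strict: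
  assumes f [measurable]: "f \<in> borel_measurable M"
    and a: "a > 0" and \<rho>: "\<rho> \<ge> 0"
    and bound: "(\<integral>\<^sup>+ \<omega>. f \<omega> \<partial>M) \<le> ennreal (\<rho> * a)"
  shows "measure M {\<omega> \<in> space M. ennreal a < f \<omega>} < \<rho> \<or>
    measure M {\<omega> \<in> space M. ennreal a < f \<omega>} = 0"
proof -
  define A where "A = {\<omega> \<in> space M. ennreal a < f \<omega>}"
  have A [measurable]: "A \<in> sets M"
    by (simp add: A_def)
  have "measure M A < \<rho>" if pos: "measure M A \<noteq> 0"
  proof -
    have "ennreal (a * measure M A) = (\<integral>\<^sup>+ \<omega>. ennreal a * indicator A \<omega> \<partial>M)"
      using a by (simp add: nn_integral_cmult_indicator emeasure_eq_measure ennreal_mult)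
    also have "\<dots> < (\<integral>\<^sup>+ \<omega>. f \<omega> \<partial>M)"
    proof (rule nn_integral_less)
      show "(\<integral>\<^sup>+ \<omega>. ennreal a * indicator A \<omega> \<partial>M) \<noteq> \<infinity>"
        by (simp add: nn_integral_cmult_indicator emeasure_eq_measure ennreal_mult_eq_top_iff)
      show "AE \<omega> in M. ennreal a * indicator A \<omega> \<le> f \<omega>"
        by (auto simp: A_def indicator_def)
      show "\<not> (AE \<omega> in M. f \<omega> \<le> ennreal a * indicator A \<omega>)"
      proof
        assume "AE \<omega> in M. f \<omega> \<le> ennreal a * indicator A \<omega>"
        then have "AE \<omega> in M. \<omega> \<notin> A"
          by eventually_elim (auto simp: A_def indicator_def)
        then show False
          using pos A by (simp add: AE_iff_null_sets[OF A, symmetric] measure_eq_0_null_sets)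
      qed
    qed simp_all
    also note bound
    finally show ?thesis
      using a by (simp add: ennreal_less_iff mult.commute)
  qed
  then show ?thesis
    by (auto simp: A_def)
qed

section \<open>Pseudo-trajectories and their measurability\<close>

text \<open>
  Quantifying over centres in a countable \<open>D\<close> near the points of the chain, rather than over the
  points themselves, makes the existence of a chain a countable union of conditions on the inputs.
\<close>

primrec pseudo_reaches ::
  "('a::metric_space \<Rightarrow> 'b \<Rightarrow> 'a set) \<Rightarrow> 'a set \<Rightarrow> 'a set \<Rightarrow> 'a set \<Rightarrow> real \<Rightarrow> 'a \<Rightarrow> 'b list \<Rightarrow> bool"
  where
  "pseudo_reaches G X D S e q [] \<longleftrightarrow> (\<exists>z\<in>S. dist q z < e)"
| "pseudo_reaches G X D S e q (v # vs) \<longleftrightarrow>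
    (\<exists>q'\<in>D. graph_at X G v \<inter> ball q e \<times> ball q' e \<noteq> {} \<and> pseudo_reaches G X D S e q' vs)"

lemma pseudo_reaches_mono:
  "pseudo_reaches G X D S e q vs \<Longrightarrow> e \<le> e' \<Longrightarrow> pseudo_reaches G X D S e' q vs"
proof (induction vs arbitrary: q)
  case Nil
  then show ?case by force
next
  case (Cons v vs)
  have "ball q e \<times> ball q' e \<subseteq> ball q e' \<times> ball q' e'" for q'
    using Cons.prems(2) by auto
  then show ?case
    using Cons by (simp, blast)
qed

text \<open>For fixed centres, one step asks that the graph meet an open box, which is the kind of
  event (A4) makes measurable; countability of \<open>D\<close> handles the choice of the next
  centre.\<close>

lemma measurable_pseudo_reaches:
  fixes G :: "'a::metric_space \<Rightarrow> 'b::topological_space \<Rightarrow> 'a set"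
  assumes G: "measurable_graph_map_on X V G" and "countable D"
    and v: "\<And>i. v i \<in> measurable M (restrict_space borel V)"
  shows "{\<omega> \<in> space M. pseudo_reaches G X D S e q (map (\<lambda>i. v i \<omega>) is)} \<in> sets M"
proof (induction "is" arbitrary: q)
  case Nil
  then show ?case by simp
next
  case (Cons i "is")
  have "{\<omega> \<in> space M. graph_at X G (v i \<omega>) \<inter> ball q e \<times> ball q' e \<noteq> {}} \<in> sets M" for q'
  proof -
    have "{w \<in> V. graph_at X G w \<inter> ball q e \<times> ball q' e \<noteq> {}} \<in> sets (restrict_space borel V)"
      using G open_Times[OF open_ball open_ball] unfolding measurable_graph_map_on_def by blast
    from measurable_sets[OF v[of i] this]
    have "v i -` {w \<in> V. graph_at X G w \<inter> ball q e \<times> ball q' e \<noteq> {}} \<inter> space M \<in> sets M" .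
    moreover have "v i \<omega> \<in> V" if "\<omega> \<in> space M" for \<omega>
      using measurable_space[OF v that] by (simp add: space_restrict_space)
    then have "v i -` {w \<in> V. graph_at X G w \<inter> ball q e \<times> ball q' e \<noteq> {}} \<inter> space M =
        {\<omega> \<in> space M. graph_at X G (v i \<omega>) \<inter> ball q e \<times> ball q' e \<noteq> {}}"
      by auto
    ultimately show ?thesis by simp
  qed
  then have "(\<Union>q'\<in>D. {\<omega> \<in> space M. graph_at X G (v i \<omega>) \<inter> ball q e \<times> ball q' e \<noteq> {}} \<inter>
      {\<omega> \<in> space M. pseudo_reaches G X D S e q' (map (\<lambda>i. v i \<omega>) is)}) \<in> sets M"
    using Cons.IH \<open>countable D\<close>
    by (intro sets.countable_UN' sets.Int) auto
  also have "(\<Union>q'\<in>D. {\<omega> \<in> space M. graph_at X G (v i \<omega>) \<inter> ball q e \<times> ball q' e \<noteq> {}} \<inter>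
      {\<omega> \<in> space M. pseudo_reaches G X D S e q' (map (\<lambda>i. v i \<omega>) is)}) =
      {\<omega> \<in> space M. pseudo_reaches G X D S e q (map (\<lambda>i. v i \<omega>) (i # is))}"
    by auto
  finally show ?case .
qed

section \<open>Comparison of \<open>lambdaB\<close> with pseudo-trajectories\<close>

locale usc_inclusion =
  fixes X :: "'a::euclidean_space set" and V :: "'b::topological_space set"
    and G :: "'a \<Rightarrow> 'b \<Rightarrow> 'a set" and B :: "'a \<Rightarrow> real"
  assumes G_into: "x \<in> X \<Longrightarrow> v \<in> V \<Longrightarrow> G x v \<subseteq> X"
    and G_nonempty: "x \<in> X \<Longrightarrow> v \<in> V \<Longrightarrow> G x v \<noteq> {}"
    and G_closed: "x \<in> X \<Longrightarrow> v \<in> V \<Longrightarrow> closed (G x v)"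
    and G_usc: "v \<in> V \<Longrightarrow> usc_set_map_on X (\<lambda>x. G x v)"
    and G_locally_bounded: "locally_bounded_set_map_on X V G"
    and B_usc: "usc_on X B"
begin

lemma compact_G:
  assumes "x \<in> X" "v \<in> V"
  shows "compact (G x v)"
proof -
  have "(x, v) \<in> X \<times> V"
    using assms by simp
  from bspec[OF G_locally_bounded[unfolded locally_bounded_set_map_on_def] this]
  obtain U c where "(x, v) \<in> U" "\<forall>(x, v)\<in>U \<inter> (X \<times> V). \<forall>y\<in>G x v. norm y \<le> c"
    by (elim exE conjE)
  then have "\<forall>y\<in>G x v. norm y \<le> c"
    using assms by fast
  then show ?thesis
    using G_closed[OF assms] by (auto simp: compact_eq_bounded_closed bounded_iff)
qed

text \<open>A supremum above \<open>c\<close> is witnessed by a true successor, and density puts a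
  centre near it. Extracting the witness takes only nonemptiness, so the lemma is available before
  the suprema are known to be finite.\<close>

lemma lambdaB_imp_pseudo_reaches:
  assumes dense: "\<And>U. open U \<Longrightarrow> U \<noteq> {} \<Longrightarrow> \<exists>d\<in>D. d \<in> U" and "0 < e"
  shows "\<lbrakk>set vs \<subseteq> V; x \<in> X; c < lambdaB G B x vs; dist q x < e\<rbrakk>
    \<Longrightarrow> pseudo_reaches G X D {z \<in> X. c \<le> B z} e q vs"
proof (induction vs arbitrary: x q)
  case Nil
  then show ?case
    by (auto intro!: bexI[of _ x] simp: dist_commute)
next
  case (Cons v vs)
  have "(\<lambda>y. lambdaB G B y vs) ` G x v \<noteq> {}" "c < (SUP y\<in>G x v. lambdaB G B y vs)"
    using Cons.prems G_nonempty by auto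
  then obtain y where y: "y \<in> G x v" "c < lambdaB G B y vs"
    by (elim less_cSupE[rotated]) auto
  have "y \<in> X"
    using G_into y Cons.prems by auto
  obtain d where d: "d \<in> D" "dist d y < e"
    using dense[of "ball y e"] \<open>0 < e\<close> by (auto simp: dist_commute)
  have "(x, y) \<in> graph_at X G v \<inter> ball q e \<times> ball d e"
    using Cons.prems y d \<open>y \<in> X\<close> by (simp add: graph_at_def)
  moreover have "pseudo_reaches G X D {z \<in> X. c \<le> B z} e d vs"
    using Cons.IH Cons.prems y d \<open>y \<in> X\<close> by simp
  ultimately show ?case
    unfolding pseudo_reaches.simps using d(1) by blast
qed

text \<open>This breaks a circularity: separation for \<open>v # vs\<close> needs finite suprema
  over \<open>vs\<close>, and these follow from separation for \<open>vs\<close>, taken here as a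
  premise. Near \<open>y\<close>, a value above \<open>lambdaB G B y vs + 1\<close> would produce a
  forbidden chain.\<close>

lemma bdd_above_lambdaB_aux:
  assumes vs: "set vs \<subseteq> V" and K: "compact K" "K \<subseteq> X"
    and separation: "\<And>y c. y \<in> K \<Longrightarrow> lambdaB G B y vs < c \<Longrightarrow>
      \<exists>\<delta>>0. \<forall>q\<in>ball y \<delta>. \<not> pseudo_reaches G X UNIV {z \<in> X. c \<le> B z} \<delta> q vs"
  shows "bdd_above ((\<lambda>y. lambdaB G B y vs) ` K)"
proof -
  \<comment> \<open>Writing the bound as \<open>1 / \<delta>\<close> makes it weaken as the radius
    shrinks, as \<open>compact_uniform_radius\<close> requires.\<close>
  have "\<exists>\<delta>>0. \<forall>y\<in>K. \<forall>q\<in>ball y \<delta>. q \<in> X \<longrightarrow> lambdaB G B q vs \<le> 1 / \<delta>"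
  proof (rule compact_uniform_radius[OF K(1)])
    fix y assume "y \<in> K"
    define c where "c = lambdaB G B y vs + 1"
    obtain d where d: "d > 0"
      "\<forall>q\<in>ball y d. \<not> pseudo_reaches G X UNIV {z \<in> X. c \<le> B z} d q vs"
      using separation[OF \<open>y \<in> K\<close>, of c] by (auto simp: c_def)
    define \<delta> where "\<delta> = min d (1 / (\<bar>c\<bar> + 1))"
    have "\<delta> > 0"
      using d by (simp add: \<delta>_def add_nonneg_pos)
    moreover have "lambdaB G B q vs \<le> 1 / \<delta>" if "q \<in> ball y \<delta>" "q \<in> X" for q
    proof -
      have "\<not> pseudo_reaches G X UNIV {z \<in> X. c \<le> B z} d q vs"
        using d(2) that(1) by (simp add: \<delta>_def)
      moreover have "pseudo_reaches G X UNIV {z \<in> X. c \<le> B z} d q vs" if "c < lambdaB G B q vs"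
        using that \<open>q \<in> X\<close> vs d(1) by (intro lambdaB_imp_pseudo_reaches[where x = q]) auto
      ultimately have "lambdaB G B q vs \<le> c"
        by force
      also have "\<dots> \<le> \<bar>c\<bar> + 1" by simp
      also have "\<dots> \<le> 1 / \<delta>"
      proof -
        have "(\<bar>c\<bar> + 1) * \<delta> \<le> (\<bar>c\<bar> + 1) * (1 / (\<bar>c\<bar> + 1))"
          by (intro mult_left_mono) (auto simp: \<delta>_def)
        also have "\<dots> = 1" by (simp add: add_nonneg_eq_0_iff)
        finally show ?thesis
          using \<open>\<delta> > 0\<close> by (simp add: pos_le_divide_eq)
      qed
      finally show ?thesis .
    qed
    ultimately show "\<exists>\<delta>>0. \<forall>q\<in>ball y \<delta>. q \<in> X \<longrightarrow> lambdaB G B q vs \<le> 1 / \<delta>"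
      by blast
  next
    fix \<delta> \<delta>' :: real and q
    assume "0 < \<delta>'" "\<delta>' \<le> \<delta>" and le: "q \<in> X \<longrightarrow> lambdaB G B q vs \<le> 1 / \<delta>"
    then have "1 / \<delta> \<le> 1 / \<delta>'"
      by (intro divide_left_mono) auto
    then show "q \<in> X \<longrightarrow> lambdaB G B q vs \<le> 1 / \<delta>'"
      using le by linarith
  qed
  then obtain \<delta> where "\<delta> > 0" "\<forall>y\<in>K. y \<in> X \<longrightarrow> lambdaB G B y vs \<le> 1 / \<delta>"
    by (meson centre_in_ball)
  then show ?thesis
    using K(2) by (auto intro!: bdd_aboveI2[of _ _ "1 / \<delta>"])
qed

text \<open>Upper semicontinuity places approximate successors of \<open>x\<close> near
  \<open>G x v\<close>, where compactness gives one tolerance excluding all continuations.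
  \<open>D\<close> is generalized because the induction hypothesis is used with \<open>UNIV\<close>
  for boundedness and with \<open>D\<close> for the chains.\<close>

lemma lambdaB_less_imp_not_pseudo_reaches:
  "\<lbrakk>set vs \<subseteq> V; x \<in> X; lambdaB G B x vs < c\<rbrakk>
    \<Longrightarrow> \<exists>\<delta>>0. \<forall>q\<in>ball x \<delta>. \<not> pseudo_reaches G X D {z \<in> X. c \<le> B z} \<delta> q vs"
proof (induction vs arbitrary: x c D)
  case Nil
  then have "\<forall>\<^sub>F y in at x within X. B y < B x + (c - B x)"
    using B_usc unfolding usc_on_def by (metis diff_gt_0_iff_gt lambdaB.simps(1))
  \<comment> \<open>The filter omits \<open>x\<close> itself; there the bound is the
    premise.\<close>
  then obtain d where d: "d > 0" "\<And>z. z \<in> X \<Longrightarrow> dist z x < d \<Longrightarrow> B z < c"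
    using Nil unfolding eventually_at by force
  have "\<not> pseudo_reaches G X D {z \<in> X. c \<le> B z} (d / 2) q []" if "dist x q < d / 2" for q
  proof -
    have "B z < c" if "z \<in> X" "dist q z < d / 2" for z
      using d(2)[OF \<open>z \<in> X\<close>] dist_triangle[of x z q] that(2) \<open>dist x q < d / 2\<close>
      by (simp add: dist_commute)
    then show ?thesis by force
  qed
  then show ?case
    using d(1) by (intro exI[of _ "d / 2"]) simp
next
  case (Cons v vs)
  let ?P = "pseudo_reaches G X D {z \<in> X. c \<le> B z}"
  have v: "v \<in> V" and vs: "set vs \<subseteq> V"
    using Cons.prems by auto
  have K: "compact (G x v)" "G x v \<subseteq> X"
    using compact_G G_into Cons.prems v by auto
  have bdd: "bdd_above ((\<lambda>y. lambdaB G B y vs) ` G x v)"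
    using K(2) by (intro bdd_above_lambdaB_aux[OF vs K] Cons.IH[OF vs]) auto
  have "\<exists>\<delta>>0. \<forall>y\<in>G x v. \<forall>q\<in>ball y \<delta>. \<not> ?P \<delta> q vs"
  proof (rule compact_uniform_radius[OF K(1)])
    fix y assume y: "y \<in> G x v"
    \<comment> \<open>Boundedness is essential here: it makes the real supremum a genuine upper
      bound.\<close>
    have "lambdaB G B y vs < c"
      using cSUP_upper[OF y bdd] Cons.prems(3) by simp
    then show "\<exists>\<delta>>0. \<forall>q\<in>ball y \<delta>. \<not> ?P \<delta> q vs"
      using Cons.IH[OF vs] K(2) y by blast
  qed (use pseudo_reaches_mono in blast)
  then obtain \<delta> where \<delta>: "\<delta> > 0" "\<And>y q. y \<in> G x v \<Longrightarrow> dist y q < \<delta> \<Longrightarrow> \<not> ?P \<delta> q vs"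
    by auto
  have "\<exists>U. open U \<and> x \<in> U \<and>
      (\<forall>y\<in>U \<inter> X. G y v \<subseteq> {a + (\<delta> / 2) *\<^sub>R b | a b. a \<in> G x v \<and> b \<in> ball 0 1})"
    using G_usc[OF v] \<open>x \<in> X\<close> half_gt_zero[OF \<delta>(1)] unfolding usc_set_map_on_def by blast
  then obtain U where U: "open U" "x \<in> U"
    "\<And>y. y \<in> U \<inter> X \<Longrightarrow> G y v \<subseteq> {a + (\<delta> / 2) *\<^sub>R b | a b. a \<in> G x v \<and> b \<in> ball 0 1}"
    by blast
  obtain r where r: "r > 0" "ball x r \<subseteq> U"
    using U openE by blast
  \<comment> \<open>Two hops \<open>x\<close>, \<open>q\<close>, \<open>a\<close> must stay within
    \<open>r\<close>. The hop from \<open>g\<close> to \<open>y\<close> costs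
    \<open>\<delta> / 2\<close>, leaving \<open>\<delta> / 2\<close> for the hop to
    \<open>q'\<close>.\<close>
  define \<eta> where "\<eta> = min (r / 2) (\<delta> / 2)"
  have \<eta>: "\<eta> > 0" "\<eta> \<le> r / 2" "\<eta> \<le> \<delta> / 2"
    using r \<delta> by (auto simp: \<eta>_def)
  have "\<not> ?P \<eta> q (v # vs)" if q: "dist x q < \<eta>" for q
  proof
    assume "?P \<eta> q (v # vs)"
    then obtain q' a y where *: "a \<in> X" "y \<in> G a v" "dist q a < \<eta>" "dist q' y < \<eta>" "?P \<eta> q' vs"
      by (auto simp: graph_at_def)
    have "dist x a < r"
      using dist_triangle[of x a q] q * \<eta> by linarith
    then have "a \<in> U \<inter> X"
      using r * by auto
    from subsetD[OF U(3)[OF this] *(2)] obtain g b where g: "y = g + (\<delta> / 2) *\<^sub>R b" "g \<in> G x v" "norm b < 1"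
      by auto
    have "dist g y < \<delta> / 2"
      using g \<delta>(1) by (simp add: dist_norm)
    then have "dist g q' < \<delta>"
      using dist_triangle[of g q' y] * \<eta> by (simp add: dist_commute)
    then have "\<not> ?P \<delta> q' vs"
      using \<delta>(2) g by blast
    moreover have "?P \<delta> q' vs"
      using *(5) by (rule pseudo_reaches_mono) (use \<eta> \<delta>(1) in linarith)
    ultimately show False by contradiction
  qed
  then show ?case
    using \<eta>(1) by (intro exI[of _ \<eta>]) simp
qed

lemma bdd_above_lambdaB:
  assumes "set vs \<subseteq> V" "compact K" "K \<subseteq> X"
  shows "bdd_above ((\<lambda>y. lambdaB G B y vs) ` K)"
proof (rule bdd_above_lambdaB_aux[OF assms])
  fix y c
  assume "y \<in> K" "lambdaB G B y vs < c"
  then show "\<exists>\<delta>>0. \<forall>q\<in>ball y \<delta>. \<not> pseudo_reaches G X UNIV {z \<in> X. c \<le> B z} \<delta> q vs"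
    using assms by (intro lambdaB_less_imp_not_pseudo_reaches) auto
qed

section \<open>Measurability of \<open>lambdaB\<close> and its link to reachability\<close>

text \<open>The two comparison lemmas leave the case of equality open. Raising the level by
  \<open>1 / real (Suc m)\<close> absorbs this gap and turns a strict superlevel set into a
  countable union of countable intersections.\<close>

lemma measurable_lambdaB:
  fixes v :: "nat \<Rightarrow> 'w \<Rightarrow> 'b"
  assumes G: "measurable_graph_map_on X V G" and "x \<in> X"
    and v: "\<And>i. v i \<in> measurable M (restrict_space borel V)"
  shows "(\<lambda>\<omega>. lambdaB G B x (map (\<lambda>i. v i \<omega>) is)) \<in> borel_measurable M"
  unfolding borel_measurable_iff_greater
proof
  fix c :: real
  obtain D :: "'a set" where D: "countable D" "\<And>U. open U \<Longrightarrow> U \<noteq> {} \<Longrightarrow> \<exists>d\<in>D. d \<in> U"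
    by (rule countable_dense_setE) blast
  define P where "P = (\<lambda>m n \<omega>. pseudo_reaches G X D {z \<in> X. c + 1 / real (Suc m) \<le> B z}
    (1 / real (Suc n)) x (map (\<lambda>i. v i \<omega>) is))"
  have "{\<omega> \<in> space M. c < lambdaB G B x (map (\<lambda>i. v i \<omega>) is)} =
      {\<omega> \<in> space M. \<exists>m. \<forall>n. P m n \<omega>}"
  proof (intro Collect_cong conj_cong refl iffI)
    fix \<omega> assume "\<omega> \<in> space M"
    then have vs: "set (map (\<lambda>i. v i \<omega>) is) \<subseteq> V"
      using measurable_space[OF v] by (auto simp: space_restrict_space)
    {
      assume "c < lambdaB G B x (map (\<lambda>i. v i \<omega>) is)"
      then have "0 < lambdaB G B x (map (\<lambda>i. v i \<omega>) is) - c" by simp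
      then obtain m where "1 / real (Suc m) < lambdaB G B x (map (\<lambda>i. v i \<omega>) is) - c"
        by (rule nat_approx_posE)
      then have "c + 1 / real (Suc m) < lambdaB G B x (map (\<lambda>i. v i \<omega>) is)" by simp
      then have "P m n \<omega>" for n
        unfolding P_def using D vs \<open>x \<in> X\<close> by (intro lambdaB_imp_pseudo_reaches) auto
      then show "\<exists>m. \<forall>n. P m n \<omega>" by blast
    next
      assume "\<exists>m. \<forall>n. P m n \<omega>"
      then obtain m where m: "\<And>n. P m n \<omega>" by blast
      show "c < lambdaB G B x (map (\<lambda>i. v i \<omega>) is)"
      proof (rule ccontr)
        assume "\<not> ?thesis"
        moreover have "0 < 1 / real (Suc m)" by simp
        ultimately have "lambdaB G B x (map (\<lambda>i. v i \<omega>) is) < c + 1 / real (Suc m)"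
          by linarith
        from lambdaB_less_imp_not_pseudo_reaches[OF vs \<open>x \<in> X\<close> this, of D]
        obtain \<delta> where \<delta>: "\<delta> > 0" "\<not> pseudo_reaches G X D {z \<in> X. c + 1 / real (Suc m) \<le> B z}
            \<delta> x (map (\<lambda>i. v i \<omega>) is)"
          by auto
        obtain n where "1 / real (Suc n) < \<delta>"
          using \<delta>(1) by (rule nat_approx_posE)
        then show False
          using pseudo_reaches_mono[OF m[of n, unfolded P_def], of \<delta>] \<delta>(2) by simp
      qed
    }
  qed
  moreover have "{\<omega> \<in> space M. P m n \<omega>} \<in> sets M" for m n
    unfolding P_def by (rule measurable_pseudo_reaches[OF G D(1) v])
  then have "{\<omega> \<in> space M. \<exists>m. \<forall>n. P m n \<omega>} \<in> sets M"
    by (intro sets.sets_Collect_countable_Ex sets.sets_Collect_countable_All)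
  ultimately show "{\<omega> \<in> space M. c < lambdaB G B x (map (\<lambda>i. v i \<omega>) is)} \<in> sets M"
    by simp
qed

text \<open>Peel off the first step: a supremum that is nonempty and bounded above exceeds
  \<open>\<Delta>\<close> exactly when some successor does.\<close>

lemma reaches_at_iff_lambdaB:
  "\<lbrakk>x \<in> X; \<forall>i<k. v i \<in> V\<rbrakk> \<Longrightarrow>
    reaches_at G (X - sublevel X B \<Delta>) k x v \<longleftrightarrow> \<Delta> < lambdaB G B x (map v [0..<k])"
proof (induction k arbitrary: x v)
  case 0
  then show ?case
    by (auto simp: reaches_at_def sublevel_def intro: exI[of _ "\<lambda>_. x"])
next
  case (Suc k)
  have v0: "v 0 \<in> V" and K: "G x (v 0) \<subseteq> X" "compact (G x (v 0))" "G x (v 0) \<noteq> {}"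
    using Suc.prems G_into compact_G G_nonempty by auto
  have "reaches_at G S (Suc k) x v \<longleftrightarrow> (\<exists>y\<in>G x (v 0). reaches_at G S k y (\<lambda>i. v (Suc i)))" for S
  proof
    assume "reaches_at G S (Suc k) x v"
    then obtain \<xi> where "\<xi> 0 = x" "\<forall>i<Suc k. \<xi> (Suc i) \<in> G (\<xi> i) (v i)" "\<xi> (Suc k) \<in> S"
      by (auto simp: reaches_at_def)
    then show "\<exists>y\<in>G x (v 0). reaches_at G S k y (\<lambda>i. v (Suc i))"
      unfolding reaches_at_def
      by (intro bexI[of _ "\<xi> 1"] exI[of _ "\<lambda>i. \<xi> (Suc i)"]) auto
  next
    assume "\<exists>y\<in>G x (v 0). reaches_at G S k y (\<lambda>i. v (Suc i))"
    then obtain \<xi> where "\<xi> 0 \<in> G x (v 0)" "\<forall>i<k. \<xi> (Suc i) \<in> G (\<xi> i) (v (Suc i))" "\<xi> k \<in> S"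
      by (auto simp: reaches_at_def)
    then show "reaches_at G S (Suc k) x v"
      unfolding reaches_at_def
      \<comment> \<open>\<open>case_nat\<close> prepends \<open>x\<close> and delays the tail
        trajectory by one index.\<close>
      by (intro exI[of _ "case_nat x \<xi>"]) (auto simp: less_Suc_eq_0_disj)
  qed
  also have "(\<exists>y\<in>G x (v 0). reaches_at G (X - sublevel X B \<Delta>) k y (\<lambda>i. v (Suc i))) \<longleftrightarrow>
      (\<exists>y\<in>G x (v 0). \<Delta> < lambdaB G B y (map (\<lambda>i. v (Suc i)) [0..<k]))"
    using K Suc by (intro bex_cong refl Suc.IH) auto
  also have "\<dots> \<longleftrightarrow> \<Delta> < (SUP y\<in>G x (v 0). lambdaB G B y (map (\<lambda>i. v (Suc i)) [0..<k]))"
    using K Suc.prems by (intro less_cSUP_iff[symmetric] bdd_above_lambdaB) auto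
  also have "\<dots> \<longleftrightarrow> \<Delta> < lambdaB G B x (map v [0..<Suc k])"
    by (simp add: upt_conv_Cons map_Suc_upt[symmetric] comp_def del: upt_Suc)
  finally show ?case .
qed

end

text \<open>No probability is below 0, so for \<open>\<rho> = 0\<close> the conclusion is that the
  event is null. \<open>R\<close> describes the event by trajectories, \<open>L\<close> by
  \<open>lambdaB\<close>.\<close>

theorem lemma23:
  fixes X :: "(real ^ 'n) set" and V :: "(real ^ 'm) set"
    and G :: "real ^ 'n \<Rightarrow> real ^ 'm \<Rightarrow> (real ^ 'n) set"
    and B :: "real ^ 'n \<Rightarrow> real"
    and M :: "'w measure" and \<mu> :: "(real ^ 'm) measure"
    and v :: "nat \<Rightarrow> 'w \<Rightarrow> real ^ 'm"
    and \<Delta> \<rho> :: real and N :: nat and x :: "real ^ 'n"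
  assumes G_into: "\<forall>x\<in>X. \<forall>v\<in>V. G x v \<subseteq> X"
    and A1: "\<forall>v\<in>V. usc_set_map_on X (\<lambda>x. G x v)"
    and A2: "locally_bounded_set_map_on X V G"
    and A3: "\<forall>x\<in>X. \<forall>v\<in>V. G x v \<noteq> {} \<and> closed (G x v) \<and> convex (G x v)"
    and A4: "measurable_graph_map_on X V G"
    and prob: "prob_space M"
    and indep: "prob_space.indep_vars M (\<lambda>_. restrict_space borel V) v UNIV"
    and ident: "\<forall>i. distr M (restrict_space borel V) (v i) = \<mu>"
    and G_convex: "convex_set_map_on X V G"
    and B_nonneg: "\<forall>x\<in>X. 0 \<le> B x"
    and B_concave: "concave_on X B"
    and B_usc: "usc_on X B"
    and \<Delta>: "\<Delta> > 0"
    and \<rho>: "0 \<le> \<rho>" "\<rho> < 1"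
    and x: "x \<in> sublevel X B \<Delta>"
    and bound: "(\<integral>\<^sup>+ \<omega>. (SUP k\<in>{1..N}. ennreal (lambdaB G B x (map (\<lambda>i. v i \<omega>) [0..<k]))) \<partial>M)
                  \<le> ennreal (\<rho> * \<Delta>)"
  shows "let R = {\<omega> \<in> space M. \<exists>k\<in>{1..N}. reaches_at G (X - sublevel X B \<Delta>) k x (\<lambda>i. v i \<omega>)};
             L = {\<omega> \<in> space M. \<exists>k\<in>{1..N}. lambdaB G B x (map (\<lambda>i. v i \<omega>) [0..<k]) > \<Delta>}
         in (\<rho> > 0 \<longrightarrow> measure M R < \<rho> \<and> measure M L < \<rho>) \<and>
            (\<rho> = 0 \<longrightarrow> measure M R = 0 \<and> measure M L = 0)"
proof -
  interpret usc_inclusion X V G B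
    using G_into A1 A2 A3 B_usc by unfold_locales auto
  interpret prob_space M by (rule prob)
  have xX: "x \<in> X"
    using x by (simp add: sublevel_def)
  have v: "v i \<in> measurable M (restrict_space borel V)" for i
    using indep by (auto simp: indep_vars_def)
  have vV: "v i \<omega> \<in> V" if "\<omega> \<in> space M" for i \<omega>
    using measurable_space[OF v that] by (simp add: space_restrict_space)
  define L where
    "L = {\<omega> \<in> space M. \<exists>k\<in>{1..N}. lambdaB G B x (map (\<lambda>i. v i \<omega>) [0..<k]) > \<Delta>}"
  let ?\<Lambda> = "\<lambda>\<omega>. SUP k\<in>{1..N}. ennreal (lambdaB G B x (map (\<lambda>i. v i \<omega>) [0..<k]))"
  have R_eq: "{\<omega> \<in> space M. \<exists>k\<in>{1..N}. reaches_at G (X - sublevel X B \<Delta>) k x (\<lambda>i. v i \<omega>)} = L"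
    unfolding L_def using vV xX by (auto simp: reaches_at_iff_lambdaB)
  have "?\<Lambda> \<in> borel_measurable M"
    using measurable_lambdaB[OF A4 xX v] by (intro borel_measurable_SUP) auto
  from markov_strict[OF this \<Delta> \<rho>(1) bound]
  have "measure M {\<omega> \<in> space M. ennreal \<Delta> < ?\<Lambda> \<omega>} < \<rho> \<or>
    measure M {\<omega> \<in> space M. ennreal \<Delta> < ?\<Lambda> \<omega>} = 0" .
  \<comment> \<open>As \<open>\<Delta> > 0\<close>, truncation by \<open>ennreal\<close> does not
    affect the comparison. For \<open>N = 0\<close> the supremum is 0 and both sets are
    empty.\<close>
  moreover have "{\<omega> \<in> space M. ennreal \<Delta> < ?\<Lambda> \<omega>} = L"
    using \<Delta> by (simp add: L_def less_SUP_iff ennreal_less_iff)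
  ultimately have "measure M L < \<rho> \<or> measure M L = 0" by simp
  then show ?thesis
    unfolding R_eq L_def[symmetric] Let_def using measure_nonneg[of M L] by auto
qed

end
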